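(* Let $N\ge2$, $k\ge1$, let $[a],[c]$ be $S_k$-orbits of $\mathbb{Z}_N^k$, and let $[b]=[(1^m,0^{k-m})]$ for some $0\le m\le k$. If $M_{[a],[b]}^{(k)[c]}\neq0$, then $M_{[a],[b]}^{(k)[c]}=1$.
   Context: $S_k$ acts on $\mathbb{Z}_N^k$ ($\mathbb{Z}_N=\mathbb{Z}/N\mathbb{Z}$) by permuting coordinates; $[x]$ denotes the orbit of $x$, and exponents in a tuple denote numbers of repetitions. For orbits $[a],[b],[c]$ let $T([a],[b],[c])=\{(x,y,z)\in[a]\times[b]\times[c] : x+y=z\}$, with $S_k$ acting by $\sigma(x,y,z)=(\sigma x,\sigma y,\sigma z)$; $M_{[a],[b]}^{(k)[c]}$ is the number of $S_k$-orbits of $T([a],[b],[c])$. *)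

theory Defs
  imports
    "HOL-Algebra.Sym_Groups"
    "HOL-Algebra.Group_Action"
    "HOL-Algebra.Elementary_Groups"
    "HOL-Algebra.Product_Groups"
begin

text \<open>
  The additive group of tuples is written multiplicatively, as everywhere in HOL-Algebra.
  Tuples are extensional functions on \<open>{1..k}\<close> with values in \<open>{0..<N}\<close> (for \<open>N > 0\<close>),
  and \<open>sym_group k\<close> consists of the permutations of \<open>{1..k}\<close>.
\<close>

abbreviation tuples :: "nat \<Rightarrow> nat \<Rightarrow> (nat \<Rightarrow> int) monoid"
  where "tuples N k \<equiv> product_group {1..k} (\<lambda>_. integer_mod_group N)"

text \<open>The inverse makes this a left action. The outer restriction is what
  \<^locale>\<open>group_action\<close> requires.\<close>

definition coord_action :: "nat \<Rightarrow> nat \<Rightarrow> (nat \<Rightarrow> nat) \<Rightarrow> (nat \<Rightarrow> int) \<Rightarrow> (nat \<Rightarrow> int)"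
  where "coord_action N k \<sigma> =
    (\<lambda>x\<in>carrier (tuples N k). \<lambda>i\<in>{1..k}. x ((inv\<^bsub>sym_group k\<^esub> \<sigma>) i))"

definition tuple_orbit :: "nat \<Rightarrow> nat \<Rightarrow> (nat \<Rightarrow> int) \<Rightarrow> (nat \<Rightarrow> int) set"
  where "tuple_orbit N k x = orbit (sym_group k) (coord_action N k) x"

definition ones_zeros :: "nat \<Rightarrow> nat \<Rightarrow> nat \<Rightarrow> int"
  where "ones_zeros k m = (\<lambda>i\<in>{1..k}. if i \<le> m then 1 else 0)"

definition sum_triples :: "nat \<Rightarrow> nat \<Rightarrow> (nat \<Rightarrow> int) set \<Rightarrow> (nat \<Rightarrow> int) set \<Rightarrow> (nat \<Rightarrow> int) set
    \<Rightarrow> ((nat \<Rightarrow> int) \<times> (nat \<Rightarrow> int) \<times> (nat \<Rightarrow> int)) set"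
  where "sum_triples N k A B C = {(x, y, z) \<in> A \<times> B \<times> C. x \<otimes>\<^bsub>tuples N k\<^esub> y = z}"

definition triple_action :: "nat \<Rightarrow> nat \<Rightarrow> (nat \<Rightarrow> int) set \<Rightarrow> (nat \<Rightarrow> int) set \<Rightarrow> (nat \<Rightarrow> int) set
    \<Rightarrow> (nat \<Rightarrow> nat) \<Rightarrow> (nat \<Rightarrow> int) \<times> (nat \<Rightarrow> int) \<times> (nat \<Rightarrow> int)
    \<Rightarrow> (nat \<Rightarrow> int) \<times> (nat \<Rightarrow> int) \<times> (nat \<Rightarrow> int)"
  where "triple_action N k A B C \<sigma> =
    (\<lambda>(x, y, z)\<in>sum_triples N k A B C.
      (coord_action N k \<sigma> x, coord_action N k \<sigma> y, coord_action N k \<sigma> z))"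

definition orbit_mult :: "nat \<Rightarrow> nat \<Rightarrow> (nat \<Rightarrow> int) set \<Rightarrow> (nat \<Rightarrow> int) set \<Rightarrow> (nat \<Rightarrow> int) set \<Rightarrow> nat"
  where "orbit_mult N k A B C =
    card (orbits (sym_group k) (sum_triples N k A B C) (triple_action N k A B C))"

text \<open>The two maps above are group actions, so the orbits in question are the usual ones.\<close>

lemma group_actionI:
  assumes G: "group G"
    and ext: "\<And>g. g \<in> carrier G \<Longrightarrow> \<phi> g \<in> extensional E"
    and closed: "\<And>g x. g \<in> carrier G \<Longrightarrow> x \<in> E \<Longrightarrow> \<phi> g x \<in> E"
    and one: "\<And>x. x \<in> E \<Longrightarrow> \<phi> \<one>\<^bsub>G\<^esub> x = x"
    and mult: "\<And>g h x. g \<in> carrier G \<Longrightarrow> h \<in> carrier G \<Longrightarrow> x \<in> E \<Longrightarrow> \<phi> (g \<otimes>\<^bsub>G\<^esub> h) x = \<phi> g (\<phi> h x)"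
  shows "group_action G E \<phi>"
proof -
  interpret group G by (rule G)
  have bij: "\<phi> g \<in> Bij E" if g: "g \<in> carrier G" for g
  proof -
    have "bij_betw (\<phi> g) E E"
    proof (rule bij_betw_byWitness[where f' = "\<phi> (inv\<^bsub>G\<^esub> g)"])
      show "\<forall>x\<in>E. \<phi> (inv\<^bsub>G\<^esub> g) (\<phi> g x) = x"
        using g mult[of "inv\<^bsub>G\<^esub> g" g] one by simp
      show "\<forall>x\<in>E. \<phi> g (\<phi> (inv\<^bsub>G\<^esub> g) x) = x"
        using g mult[of g "inv\<^bsub>G\<^esub> g"] one by simp
    qed (use g closed in auto)
    then show ?thesis using ext g by (simp add: Bij_def)
  qed
  have "\<phi> (g \<otimes>\<^bsub>G\<^esub> h) = compose E (\<phi> g) (\<phi> h)" if "g \<in> carrier G" "h \<in> carrier G" for g h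
    using that by (intro extensionalityI[of _ E] ext) (auto simp: compose_eq mult)
  then have "\<phi> \<in> hom G (BijGroup E)"
    using bij by (auto simp: hom_def BijGroup_def)
  then show ?thesis
    by (simp add: group_action_def group_hom_def group_hom_axioms_def G group_BijGroup)
qed

lemma inv_sym_group_mem:
  assumes "\<sigma> \<in> carrier (sym_group k)" "i \<in> {1..k}"
  shows "(inv\<^bsub>sym_group k\<^esub> \<sigma>) i \<in> {1..k}"
proof -
  have "inv\<^bsub>sym_group k\<^esub> \<sigma> permutes {1..k}"
    using group.inv_closed[OF sym_group_is_group assms(1)] by (simp only: sym_group_carrier)
  then show ?thesis
    using assms(2) by (simp only: permutes_in_image)
qed

lemma coord_action_apply:
  assumes "x \<in> carrier (tuples N k)" "i \<in> {1..k}"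
  shows "coord_action N k \<sigma> x i = x ((inv\<^bsub>sym_group k\<^esub> \<sigma>) i)"
  using assms by (simp add: coord_action_def)

lemma coord_action_closed:
  assumes "\<sigma> \<in> carrier (sym_group k)" "x \<in> carrier (tuples N k)"
  shows "coord_action N k \<sigma> x \<in> carrier (tuples N k)"
  using assms inv_sym_group_mem[OF assms(1)]
  by (auto simp: coord_action_def PiE_iff simp del: atLeastAtMost_iff)

lemma group_action_coord: "group_action (sym_group k) (carrier (tuples N k)) (coord_action N k)"
proof (rule group_actionI[OF sym_group_is_group])
  interpret S: group "sym_group k" by (rule sym_group_is_group)
  fix g h x
  assume x: "x \<in> carrier (tuples N k)"
  show "coord_action N k \<one>\<^bsub>sym_group k\<^esub> x = x"
    using x by (intro extensionalityI[of _ "{1..k}"])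
      (auto simp: coord_action_def sym_group_one[of k] S.inv_one[simplified sym_group_one] PiE_iff)
  assume g: "g \<in> carrier (sym_group k)" and h: "h \<in> carrier (sym_group k)"
  have hx: "coord_action N k h x \<in> carrier (tuples N k)"
    by (rule coord_action_closed[OF h x])
  show "coord_action N k (g \<otimes>\<^bsub>sym_group k\<^esub> h) x = coord_action N k g (coord_action N k h x)"
  proof (rule extensionalityI[of _ "{1..k}"])
    fix i assume i: "i \<in> {1..k}"
    show "coord_action N k (g \<otimes>\<^bsub>sym_group k\<^esub> h) x i = coord_action N k g (coord_action N k h x) i"
      unfolding coord_action_apply[OF x i] coord_action_apply[OF hx i]
        coord_action_apply[OF x inv_sym_group_mem[OF g i]] S.inv_mult_group[OF g h]
      by (simp add: sym_group_mult)
  qed (use x hx in \<open>simp_all add: coord_action_def\<close>)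
next
  show "coord_action N k g \<in> extensional (carrier (tuples N k))" for g
    by (simp add: coord_action_def)
  show "coord_action N k g x \<in> carrier (tuples N k)"
    if "g \<in> carrier (sym_group k)" "x \<in> carrier (tuples N k)" for g x
    using that by (rule coord_action_closed)
qed

lemma coord_action_mult:
  assumes "\<sigma> \<in> carrier (sym_group k)" "x \<in> carrier (tuples N k)" "y \<in> carrier (tuples N k)"
  shows "coord_action N k \<sigma> (x \<otimes>\<^bsub>tuples N k\<^esub> y) =
    coord_action N k \<sigma> x \<otimes>\<^bsub>tuples N k\<^esub> coord_action N k \<sigma> y"
proof -
  interpret T: group "tuples N k" by simp
  have xy: "x \<otimes>\<^bsub>tuples N k\<^esub> y \<in> carrier (tuples N k)"
    using assms by (intro T.m_closed)
  show ?thesis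
    unfolding coord_action_def restrict_apply'[OF xy] restrict_apply'[OF assms(2)]
      restrict_apply'[OF assms(3)]
    using inv_sym_group_mem[OF assms(1)]
    by (auto intro!: restrict_ext simp: product_group_def simp del: atLeastAtMost_iff)
qed

lemma tuple_orbit_subset:
  assumes "x \<in> carrier (tuples N k)"
  shows "tuple_orbit N k x \<subseteq> carrier (tuples N k)"
  using coord_action_closed[OF _ assms] by (auto simp: tuple_orbit_def orbit_def)

lemma tuple_orbit_closed:
  assumes "x \<in> carrier (tuples N k)" "y \<in> tuple_orbit N k x" "\<sigma> \<in> carrier (sym_group k)"
  shows "coord_action N k \<sigma> y \<in> tuple_orbit N k x"
proof -
  interpret S: group "sym_group k" by (rule sym_group_is_group)
  obtain \<tau> where \<tau>: "\<tau> \<in> carrier (sym_group k)" and y: "y = coord_action N k \<tau> x"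
    using assms(2) unfolding tuple_orbit_def orbit_def by (elim CollectE exE conjE)
  interpret A: group_action "sym_group k" "carrier (tuples N k)" "coord_action N k"
    by (rule group_action_coord)
  have "coord_action N k \<sigma> y = coord_action N k (\<sigma> \<otimes>\<^bsub>sym_group k\<^esub> \<tau>) x"
    unfolding y using A.composition_rule[OF assms(1,3) \<tau>] by (rule sym)
  moreover have "\<sigma> \<otimes>\<^bsub>sym_group k\<^esub> \<tau> \<in> carrier (sym_group k)"
    using assms(3) \<tau> by (rule S.m_closed)
  ultimately show ?thesis
    unfolding tuple_orbit_def orbit_def by (intro CollectI exI conjI)
qed

lemma group_action_triple:
  assumes "a \<in> carrier (tuples N k)" "b \<in> carrier (tuples N k)" "c \<in> carrier (tuples N k)"
  defines "A \<equiv> tuple_orbit N k a" and "B \<equiv> tuple_orbit N k b" and "C \<equiv> tuple_orbit N k c"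
  shows "group_action (sym_group k) (sum_triples N k A B C) (triple_action N k A B C)"
proof (rule group_actionI[OF sym_group_is_group])
  note sub = subsetD[OF tuple_orbit_subset[OF assms(1)], folded A_def]
    subsetD[OF tuple_orbit_subset[OF assms(2)], folded B_def]
    subsetD[OF tuple_orbit_subset[OF assms(3)], folded C_def]
  note cl = tuple_orbit_closed[OF assms(1), folded A_def]
    tuple_orbit_closed[OF assms(2), folded B_def]
    tuple_orbit_closed[OF assms(3), folded C_def]
  have closed: "triple_action N k A B C g t \<in> sum_triples N k A B C"
    if "g \<in> carrier (sym_group k)" "t \<in> sum_triples N k A B C" for g t
    using that cl sub coord_action_mult[OF that(1), symmetric]
    by (auto simp: triple_action_def sum_triples_def simp del: carrier_product_group)
  show "triple_action N k A B C g t \<in> sum_triples N k A B C"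
    if "g \<in> carrier (sym_group k)" "t \<in> sum_triples N k A B C" for g t
    using that by (rule closed)
  have one: "coord_action N k \<one>\<^bsub>sym_group k\<^esub> x = x" if "x \<in> carrier (tuples N k)" for x
    using group_action.id_eq_one[OF group_action_coord] that by (metis restrict_apply')
  show "triple_action N k A B C \<one>\<^bsub>sym_group k\<^esub> t = t" if "t \<in> sum_triples N k A B C" for t
    using that one sub by (auto simp: triple_action_def sum_triples_def simp del: carrier_product_group)
  show "triple_action N k A B C (g \<otimes>\<^bsub>sym_group k\<^esub> h) t =
      triple_action N k A B C g (triple_action N k A B C h t)"
    if "g \<in> carrier (sym_group k)" "h \<in> carrier (sym_group k)" "t \<in> sum_triples N k A B C" for g h t
  proof -
    obtain x y z where t: "t = (x, y, z)" by (cases t)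
    have m: "x \<in> A" "y \<in> B" "z \<in> C" using that(3) by (auto simp: t sum_triples_def)
    have ht: "triple_action N k A B C h t =
        (coord_action N k h x, coord_action N k h y, coord_action N k h z)"
      using that(3) by (simp add: triple_action_def t)
    show ?thesis
      unfolding ht using closed[OF that(2,3), unfolded ht] that(3) m sub
        group_action.composition_rule[OF group_action_coord _ that(1,2)]
      by (simp add: triple_action_def t del: carrier_product_group)
  qed
qed (simp add: triple_action_def)

end

theory Submission
  imports Defs
begin

text \<open>
  A pair \<open>(x, y)\<close> of tuples is determined up to simultaneous permutation of the coordinates by
  the multiset of its columns \<open>(x\<^sub>i, y\<^sub>i)\<close>, and \<open>z = x + y\<close> follows along. So the claim is that the
  multisets of entries of \<open>x\<close>, \<open>y\<close> and \<open>x + y\<close> already determine the multiset of columns when all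
  entries of \<open>y\<close> are \<open>0\<close> or \<open>1\<close>.

  Let \<open>p\<^sub>v\<close> be the number of columns \<open>(v, 1)\<close>. There are \<open>a\<^sub>v - p\<^sub>v\<close> columns \<open>(v, 0)\<close>, where \<open>a\<^sub>v\<close>
  counts the entries \<open>v\<close> of \<open>x\<close>, so it is enough to recover all \<open>p\<^sub>v\<close>. An entry \<open>v\<close> of \<open>x + y\<close> comes
  from a column \<open>(v, 0)\<close> or \<open>(v - 1, 1)\<close>, so the number of these entries is
  \<open>c\<^sub>v = a\<^sub>v - p\<^sub>v + p\<^bsub>v-1\<^esub>\<close>. This fixes the differences
  of \<open>p\<close> around the cycle of residues, hence fixes \<open>p\<close> up to an additive constant. The constant is
  fixed by the sum of all \<open>p\<^sub>v\<close>, which is the number of ones in \<open>y\<close>. This is the content of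
  \<open>column_mset_unique\<close>; together with \<open>simultaneous_permutation\<close> it makes the action on the
  triples transitive.
\<close>

section \<open>Columns are determined by the entries of both summands and of the sum\<close>

lemma count_image_mset_of_bool:
  assumes "finite I"
  shows "int (count (image_mset f (mset_set I)) v) = (\<Sum>i\<in>I. of_bool (f i = v))"
  using assms by (simp add: count_image_mset' Int_def conj_commute eq_commute flip: of_bool_def)

lemma image_mset_eq_iff_of_bool:
  assumes "finite I"
  shows "image_mset f (mset_set I) = image_mset g (mset_set I) \<longleftrightarrow>
    (\<forall>v. (\<Sum>i\<in>I. of_bool (f i = v)) = (\<Sum>i\<in>I. of_bool (g i = v) :: int))"
  unfolding count_image_mset_of_bool[OF assms, symmetric] by (simp add: multiset_eq_iff)

lemma add_one_mod_eq_iff: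
  fixes N x v :: int
  assumes "x \<in> {0..<N}" "v \<in> {0..<N}"
  shows "(x + 1) mod N = v \<longleftrightarrow> x = (v - 1) mod N"
proof
  assume "(x + 1) mod N = v"
  then have "(v - 1) mod N = (x + 1 - 1) mod N" by (metis mod_diff_left_eq)
  then show "x = (v - 1) mod N" using assms by simp
next
  assume "x = (v - 1) mod N"
  then have "(x + 1) mod N = (v - 1 + 1) mod N" by (metis mod_add_left_eq)
  then show "(x + 1) mod N = v" using assms by simp
qed

text \<open>A function on the residues that is invariant under the cyclic shift is constant, and its sum
  is \<open>N\<close> times the constant.\<close>

lemma cyclic_invariant_sum_zero:
  fixes d :: "int \<Rightarrow> int" and N :: nat
  assumes step: "\<And>v. v \<in> {0..<int N} \<Longrightarrow> d v = d ((v - 1) mod int N)"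
    and sum: "(\<Sum>v\<in>{0..<int N}. d v) = 0"
    and v: "v \<in> {0..<int N}"
  shows "d v = 0"
proof -
  have const: "d (int n) = d 0" if "n < N" for n
    using that
  proof (induction n)
    case (Suc n)
    have "d (int (Suc n)) = d (int n mod int N)" using step[of "int (Suc n)"] Suc.prems by simp
    then show ?case using Suc by simp
  qed simp
  have d0: "d w = d 0" if "w \<in> {0..<int N}" for w
    using const[of "nat w"] that by auto
  have "(\<Sum>v\<in>{0..<int N}. d v) = (\<Sum>v\<in>{0..<int N}. d 0)" by (rule sum.cong[OF refl d0])
  also have "\<dots> = int N * d 0" by simp
  finally have "(\<Sum>v\<in>{0..<int N}. d v) = int N * d 0" .
  then show ?thesis using sum d0[OF v] v by simp
qed

lemma sum_column_counts:
  fixes x y :: "'i \<Rightarrow> int"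
  assumes "finite I" and x: "\<And>i. i \<in> I \<Longrightarrow> x i \<in> V" and "finite V"
  shows "(\<Sum>v\<in>V. \<Sum>i\<in>I. of_bool (x i = v \<and> y i = 1)) = (\<Sum>i\<in>I. of_bool (y i = 1) :: int)"
proof -
  have "(\<Sum>v\<in>V. of_bool (x i = v \<and> y i = 1)) = (of_bool (y i = 1) :: int)" if "i \<in> I" for i
    using x[OF that] \<open>finite V\<close> by (simp add: of_bool_conj of_bool_def)
  then show ?thesis by (subst sum.swap) simp
qed

text \<open>An entry \<open>v\<close> of the sum comes from a column \<open>(v, 0)\<close> or \<open>(v - 1, 1)\<close>; the columns \<open>(v, 0)\<close>
  are counted as those with first entry \<open>v\<close> other than \<open>(v, 1)\<close>. Only the counts of columns with
  second entry \<open>1\<close> then remain unknown.\<close>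

lemma column_count_step:
  fixes x y :: "'i \<Rightarrow> int" and N :: int
  assumes x: "\<And>i. i \<in> I \<Longrightarrow> x i \<in> {0..<N}" and y: "\<And>i. i \<in> I \<Longrightarrow> y i \<in> {0, 1}"
    and v: "v \<in> {0..<N}"
  shows "(\<Sum>i\<in>I. of_bool ((x i + y i) mod N = v)) =
    (\<Sum>i\<in>I. of_bool (x i = v)) - (\<Sum>i\<in>I. of_bool (x i = v \<and> y i = 1))
      + (\<Sum>i\<in>I. of_bool (x i = (v - 1) mod N \<and> y i = 1) :: int)"
proof -
  have "of_bool ((x i + y i) mod N = v) =
      (of_bool (x i = v) - of_bool (x i = v \<and> y i = 1)
        + of_bool (x i = (v - 1) mod N \<and> y i = 1) :: int)"
    if i: "i \<in> I" for i
  proof (cases "y i = 1")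
    case True
    then show ?thesis using add_one_mod_eq_iff[OF x[OF i] v] by simp
  next
    case False
    then show ?thesis using x[OF i] y[OF i] by simp
  qed
  then show ?thesis by (simp add: sum.distrib sum_subtractf)
qed

text \<open>By the previous lemma, the counts of the columns \<open>(v, 1)\<close> for the two pairs have the same
  differences along the cycle of residues. Both families sum to the number of ones in the second
  tuple, so they agree.\<close>

lemma column_mset_unique:
  fixes x y x' y' :: "'i \<Rightarrow> int" and N :: nat
  assumes I: "finite I"
    and x: "\<And>i. i \<in> I \<Longrightarrow> x i \<in> {0..<int N}" and y: "\<And>i. i \<in> I \<Longrightarrow> y i \<in> {0, 1}"
    and x': "\<And>i. i \<in> I \<Longrightarrow> x' i \<in> {0..<int N}" and y': "\<And>i. i \<in> I \<Longrightarrow> y' i \<in> {0, 1}"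
    and eqx: "image_mset x (mset_set I) = image_mset x' (mset_set I)"
    and eqy: "image_mset y (mset_set I) = image_mset y' (mset_set I)"
    and eqz: "image_mset (\<lambda>i. (x i + y i) mod int N) (mset_set I) =
      image_mset (\<lambda>i. (x' i + y' i) mod int N) (mset_set I)"
  shows "image_mset (\<lambda>i. (x i, y i)) (mset_set I) = image_mset (\<lambda>i. (x' i, y' i)) (mset_set I)"
proof -
  define p where "p = (\<lambda>v. \<Sum>i\<in>I. of_bool (x i = v \<and> y i = 1) :: int)"
  define p' where "p' = (\<lambda>v. \<Sum>i\<in>I. of_bool (x' i = v \<and> y' i = 1) :: int)"
  note ex = eqx[unfolded image_mset_eq_iff_of_bool[OF I], rule_format]
  note ey = eqy[unfolded image_mset_eq_iff_of_bool[OF I], rule_format]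
  note ez = eqz[unfolded image_mset_eq_iff_of_bool[OF I], rule_format]
  have "p v - p' v = 0" if "v \<in> {0..<int N}" for v
  proof (rule cyclic_invariant_sum_zero[of N "\<lambda>v. p v - p' v", OF _ _ that])
    fix v assume v: "v \<in> {0..<int N}"
    show "p v - p' v = p ((v - 1) mod int N) - p' ((v - 1) mod int N)"
      using column_count_step[of I x "int N" y v, OF x y v]
        column_count_step[of I x' "int N" y' v, OF x' y' v] ex[of v] ez[of v]
      unfolding p_def p'_def by linarith
  next
    show "(\<Sum>v\<in>{0..<int N}. p v - p' v) = 0"
      unfolding sum_subtractf p_def p'_def using ey[of 1]
      by (simp add: sum_column_counts[OF I x] sum_column_counts[OF I x'])
  qed
  moreover have "p v = 0" "p' v = 0" if "v \<notin> {0..<int N}" for v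
    unfolding p_def p'_def using that x x' by (auto intro!: sum.neutral)
  ultimately have p: "p v = p' v" for v by (cases "v \<in> {0..<int N}") auto
  \<comment> \<open>The columns with second entry \<open>0\<close> are the remaining ones.\<close>
  have split: "(\<Sum>i\<in>I. of_bool ((u i, w i) = (v, e)) :: int) =
      (if e = 1 then \<Sum>i\<in>I. of_bool (u i = v \<and> w i = 1)
       else if e = 0 then (\<Sum>i\<in>I. of_bool (u i = v)) - (\<Sum>i\<in>I. of_bool (u i = v \<and> w i = 1))
       else 0)"
    if w: "\<And>i. i \<in> I \<Longrightarrow> w i \<in> {0, 1}" for u w :: "'i \<Rightarrow> int" and v e :: int
  proof -
    have "(of_bool ((u i, w i) = (v, e)) :: int) =
        (if e = 1 then of_bool (u i = v \<and> w i = 1)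
         else if e = 0 then of_bool (u i = v) - of_bool (u i = v \<and> w i = 1) else 0)"
      if "i \<in> I" for i
      using w[OF that] by auto
    then show ?thesis by (simp add: sum_subtractf)
  qed
  have "(\<Sum>i\<in>I. of_bool ((x i, y i) = q) :: int) = (\<Sum>i\<in>I. of_bool ((x' i, y' i) = q))" for q
    using p[of "fst q", unfolded p_def p'_def] ex[of "fst q"]
      split[of y x "fst q" "snd q", OF y] split[of y' x' "fst q" "snd q", OF y']
    by simp
  then show ?thesis by (simp only: image_mset_eq_iff_of_bool[OF I] simp_thms)
qed

section \<open>Orbits of tuples and multisets of entries\<close>

lemma tuple_entry:
  assumes "N > 0" "x \<in> carrier (tuples N k)" "i \<in> {1..k}"
  shows "x i \<in> {0..<int N}"
  using assms PiE_mem[of x "{1..k}" "\<lambda>_. carrier (integer_mod_group N)" i]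
  by (simp add: carrier_integer_mod_group)

lemma tuples_mult_apply:
  assumes "i \<in> {1..k}"
  shows "(x \<otimes>\<^bsub>tuples N k\<^esub> y) i = (x i + y i) mod int N"
  using assms by (simp add: product_group_def)

lemma ones_zeros_carrier:
  assumes "N \<ge> 2"
  shows "ones_zeros k m \<in> carrier (tuples N k)"
  using assms by (auto simp: ones_zeros_def carrier_integer_mod_group)

lemma tuple_orbit_image_mset:
  assumes x: "x \<in> carrier (tuples N k)" and y: "y \<in> tuple_orbit N k x"
  shows "image_mset y (mset_set {1..k}) = image_mset x (mset_set {1..k})"
proof -
  obtain \<sigma> where \<sigma>: "\<sigma> \<in> carrier (sym_group k)" and y: "y = coord_action N k \<sigma> x"
    using y unfolding tuple_orbit_def orbit_def by blast
  have "inv\<^bsub>sym_group k\<^esub> \<sigma> permutes {1..k}"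
    using group.inv_closed[OF sym_group_is_group \<sigma>] by (simp only: sym_group_carrier)
  then show ?thesis
    by (rule permutes_implies_image_mset_eq[symmetric]) (simp only: y coord_action_apply[OF x])
qed

lemma ones_zeros_orbit_entry:
  assumes "N \<ge> 2" "y \<in> tuple_orbit N k (ones_zeros k m)" "i \<in> {1..k}"
  shows "y i \<in> {0, 1}"
proof -
  have "y ` {1..k} = ones_zeros k m ` {1..k}"
    using tuple_orbit_image_mset[OF ones_zeros_carrier[OF assms(1)] assms(2), THEN arg_cong, of set_mset]
    by simp
  also have "\<dots> \<subseteq> {0, 1}" by (auto simp: ones_zeros_def)
  finally show ?thesis using assms(3) by blast
qed

text \<open>A pair of tuples is a single map from coordinates to columns, and two such maps with the same
  multiset of values differ by a permutation of the coordinates.\<close>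

lemma simultaneous_permutation:
  assumes x: "x \<in> carrier (tuples N k)" and y: "y \<in> carrier (tuples N k)"
    and x': "x' \<in> carrier (tuples N k)" and y': "y' \<in> carrier (tuples N k)"
    and eq: "image_mset (\<lambda>i. (x' i, y' i)) (mset_set {1..k}) =
      image_mset (\<lambda>i. (x i, y i)) (mset_set {1..k})"
  obtains \<sigma> where "\<sigma> \<in> carrier (sym_group k)"
    "coord_action N k \<sigma> x = x'" "coord_action N k \<sigma> y = y'"
proof -
  interpret S: group "sym_group k" by (rule sym_group_is_group)
  obtain p where p: "p permutes {1..k}"
    and px: "\<forall>i\<in>{1..k}. (x' i, y' i) = (x (p i), y (p i))"
    using image_mset_eq_implies_permutes[OF finite_atLeastAtMost eq] by blast
  \<comment> \<open>The action precomposes with the inverse, so the group element is the inverse of \<open>p\<close>.\<close>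
  have pc: "p \<in> carrier (sym_group k)" using p by (simp only: sym_group_carrier)
  define \<sigma> where "\<sigma> = inv\<^bsub>sym_group k\<^esub> p"
  have \<sigma>: "\<sigma> \<in> carrier (sym_group k)" and inv: "inv\<^bsub>sym_group k\<^esub> \<sigma> = p"
    unfolding \<sigma>_def using pc by (rule S.inv_closed, rule S.inv_inv)
  have act: "coord_action N k \<sigma> u = u'"
    if u: "u \<in> carrier (tuples N k)" and u': "u' \<in> carrier (tuples N k)"
      and eq: "\<And>i. i \<in> {1..k} \<Longrightarrow> u' i = u (p i)" for u u'
  proof (rule extensionalityI[of _ "{1..k}"])
    show "coord_action N k \<sigma> u \<in> extensional {1..k}" "u' \<in> extensional {1..k}"
      using coord_action_closed[OF \<sigma> u] u' by (simp_all add: PiE_iff)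
  qed (simp only: coord_action_apply[OF u] inv eq)
  show ?thesis using \<sigma> act[OF x x'] act[OF y y'] px by (intro that) auto
qed

theorem theorem3p0p9:
  fixes N k m :: nat and a c :: "nat \<Rightarrow> int"
  assumes "N \<ge> 2" and "k \<ge> 1" and "m \<le> k"
    and "a \<in> carrier (tuples N k)" and "c \<in> carrier (tuples N k)"
    and "orbit_mult N k (tuple_orbit N k a) (tuple_orbit N k (ones_zeros k m)) (tuple_orbit N k c) \<noteq> 0"
  shows "orbit_mult N k (tuple_orbit N k a) (tuple_orbit N k (ones_zeros k m)) (tuple_orbit N k c) = 1"
proof -
  define A where "A = tuple_orbit N k a"
  define B where "B = tuple_orbit N k (ones_zeros k m)"
  define C where "C = tuple_orbit N k c"
  define T where "T = sum_triples N k A B C"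
  note b = ones_zeros_carrier[OF assms(1), of k m]
  have N: "N > 0" using assms(1) by simp
  interpret group_action "sym_group k" T "triple_action N k A B C"
    unfolding T_def A_def B_def C_def by (rule group_action_triple[OF assms(4) b assms(5)])
  note sub = subsetD[OF tuple_orbit_subset[OF assms(4)], folded A_def]
    subsetD[OF tuple_orbit_subset[OF b], folded B_def]
  have transitive: "\<exists>\<sigma>\<in>carrier (sym_group k). triple_action N k A B C \<sigma> t = t'"
    if t: "t \<in> T" and t': "t' \<in> T" for t t'
  proof -
    obtain x y where xy: "x \<in> A" "y \<in> B" "x \<otimes>\<^bsub>tuples N k\<^esub> y \<in> C"
      and t_eq: "t = (x, y, x \<otimes>\<^bsub>tuples N k\<^esub> y)"
      using t unfolding T_def sum_triples_def by blast
    obtain x' y' where xy': "x' \<in> A" "y' \<in> B" "x' \<otimes>\<^bsub>tuples N k\<^esub> y' \<in> C"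
      and t'_eq: "t' = (x', y', x' \<otimes>\<^bsub>tuples N k\<^esub> y')"
      using t' unfolding T_def sum_triples_def by blast
    note car = sub(1)[OF xy(1)] sub(2)[OF xy(2)] sub(1)[OF xy'(1)] sub(2)[OF xy'(2)]
    have "image_mset (\<lambda>i. (x' i, y' i)) (mset_set {1..k}) =
        image_mset (\<lambda>i. (x i, y i)) (mset_set {1..k})"
    proof (rule column_mset_unique[where N = N, OF finite_atLeastAtMost])
      show "image_mset x' (mset_set {1..k}) = image_mset x (mset_set {1..k})"
        using xy(1) xy'(1) tuple_orbit_image_mset[OF assms(4)] unfolding A_def by metis
      show "image_mset y' (mset_set {1..k}) = image_mset y (mset_set {1..k})"
        using xy(2) xy'(2) tuple_orbit_image_mset[OF b] unfolding B_def by metis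
      have "image_mset (x' \<otimes>\<^bsub>tuples N k\<^esub> y') (mset_set {1..k}) =
          image_mset (x \<otimes>\<^bsub>tuples N k\<^esub> y) (mset_set {1..k})"
        using xy(3) xy'(3) tuple_orbit_image_mset[OF assms(5)] unfolding C_def by metis
      moreover have "image_mset (u \<otimes>\<^bsub>tuples N k\<^esub> w) (mset_set {1..k}) =
          image_mset (\<lambda>i. (u i + w i) mod int N) (mset_set {1..k})" for u w
        by (rule image_mset_cong) (simp add: tuples_mult_apply)
      ultimately show "image_mset (\<lambda>i. (x' i + y' i) mod int N) (mset_set {1..k}) =
          image_mset (\<lambda>i. (x i + y i) mod int N) (mset_set {1..k})"
        by (simp only:)
    qed (use tuple_entry[OF N car(1)] tuple_entry[OF N car(3)]
        ones_zeros_orbit_entry[OF assms(1)] xy(2) xy'(2) B_def in blast)+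
    then obtain \<sigma> where \<sigma>: "\<sigma> \<in> carrier (sym_group k)"
      and "coord_action N k \<sigma> x = x'" "coord_action N k \<sigma> y = y'"
      by (rule simultaneous_permutation[OF car])
    then have "triple_action N k A B C \<sigma> t = t'"
      using t coord_action_mult[OF \<sigma> car(1,2)] unfolding T_def t_eq t'_eq
      by (simp add: triple_action_def)
    then show ?thesis using \<sigma> by blast
  qed
  have "orbit (sym_group k) (triple_action N k A B C) t = T" if "t \<in> T" for t
    using transitive[OF that] element_image[OF _ that] unfolding orbit_def by blast
  then have "orbits (sym_group k) T (triple_action N k A B C) \<subseteq> {T}"
    unfolding orbits_def by blast
  moreover have "orbits (sym_group k) T (triple_action N k A B C) \<noteq> {}"
    using assms(6) unfolding orbit_mult_def A_def B_def C_def T_def by (metis card.empty)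
  ultimately have "orbits (sym_group k) T (triple_action N k A B C) = {T}" by blast
  then show ?thesis unfolding orbit_mult_def A_def B_def C_def T_def by simp
qed

end
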